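(* For all $n,q\in\mathbb{N}$ and all $i,k\in\{0\}\cup\mathbb{N}$, $$\lim_{z\to-k}\frac{\Gamma^{(i)}(nz)}{\Gamma^{(i)}(qz)}=(-1)^{(n-q)k}\biggl(\frac{q}{n}\biggr)^{i+1}\frac{(qk)!}{(nk)!}.$$
   Context: $\mathbb{N}$ denotes the set of all positive integers. $\Gamma$ is the (meromorphically continued) Euler gamma function of a complex variable, analytic on the complex plane except at the points $z=-m$, $m\in\{0\}\cup\mathbb{N}$, where it has simple poles with residue $\frac{(-1)^m}{m!}$. $\Gamma^{(i)}$ denotes the $i$-th derivative of $\Gamma$ (with $\Gamma^{(0)}=\Gamma$), and $\Gamma^{(i)}(nz)$ means $\Gamma^{(i)}$ evaluated at the point $nz$ (not the $i$-th derivative of $z\mapsto\Gamma(nz)$). The limit is taken over complex $z\to -k$, $z\neq -k$. *)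

theory Defs
  imports "HOL-Analysis.Analysis"
begin

end

theory Submission
  imports Defs "HOL-Complex_Analysis.Complex_Analysis"
begin

text \<open>
  If \<open>(z - a)^p f(z)\<close> tends to \<open>c\<close> at an isolated singularity, it extends holomorphically to
  some \<open>g\<close>, and \<open>(z - a)^(p + 1) f'(z) = (z - a) g'(z) - p (z - a)^p f(z)\<close> tends to \<open>-p c\<close>.
  Iterating from the simple pole of Gamma at \<open>-m\<close> gives the leading coefficient
  \<open>(-1)^i i! (-1)^m / m!\<close> of the pole of order \<open>i + 1\<close> of its \<open>i\<close>-th derivative. With \<open>m = nk\<close>
  and \<open>m = qk\<close>, and \<open>nz + nk = n (z + k)\<close>, the powers of \<open>z + k\<close> cancel in the ratio.
\<close>

lemma deriv_times_power_tendsto: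
  fixes f :: "complex \<Rightarrow> complex"
  assumes S: "open S" "a \<in> S" and holo: "f holomorphic_on S - {a}"
    and lim: "((\<lambda>z. f z * (z - a) ^ p) \<longlongrightarrow> c) (at a)"
  shows "((\<lambda>z. deriv f z * (z - a) ^ Suc p) \<longlongrightarrow> - of_nat p * c) (at a)"
proof -
  \<comment> \<open>The removable singularity theorem asks that \<open>z - a\<close> times the
    function tend to 0; convergence to \<open>c\<close> gives this.\<close>
  have "((\<lambda>z. (z - a) * (f z * (z - a) ^ p)) \<longlongrightarrow> (a - a) * c) (at a)"
    by (intro tendsto_intros lim)
  moreover have "(\<lambda>z. f z * (z - a) ^ p) holomorphic_on S - {a}"
    by (intro holomorphic_intros holo)
  ultimately obtain g where g: "g holomorphic_on S"
    and g_eq: "\<And>z. z \<in> S - {a} \<Longrightarrow> g z = f z * (z - a) ^ p"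
    using holomorphic_on_extend_lim[of "\<lambda>z. f z * (z - a) ^ p" S a] S
    by (auto simp: interior_open)
  have g': "deriv f z * (z - a) ^ Suc p = (z - a) * deriv g z - of_nat p * (f z * (z - a) ^ p)"
    if z: "z \<in> S - {a}" for z
  proof -
    have op: "open (S - {a})"
      using S by auto
    have f': "(f has_field_derivative deriv f z) (at z)"
      using holo op z by (rule holomorphic_derivI)
    have "((\<lambda>z. f z * (z - a) ^ p) has_field_derivative
        f z * (of_nat p * (z - a) ^ (p - 1)) + deriv f z * (z - a) ^ p) (at z)"
      by (rule derivative_eq_intros f' refl | simp)+
    then have "(g has_field_derivative
        f z * (of_nat p * (z - a) ^ (p - 1)) + deriv f z * (z - a) ^ p) (at z)"
      by (rule has_field_derivative_transform_within_open[OF _ op z]) (simp add: g_eq)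
    then have dg: "deriv g z = f z * (of_nat p * (z - a) ^ (p - 1)) + deriv f z * (z - a) ^ p"
      by (rule DERIV_imp_deriv)
    show ?thesis
    \<comment> \<open>For \<open>p = 0\<close> the truncated exponent \<open>p - 1\<close> is
      harmless, as its coefficient vanishes; otherwise \<open>z - a\<close> restores the power
      \<open>p\<close>.\<close>
    proof (cases p)
      case 0
      then show ?thesis
        by (simp add: dg)
    next
      case (Suc m)
      \<comment> \<open>Naming the difference keeps \<open>algebra_simps\<close> from expanding
        it.\<close>
      define w where "w = z - a"
      show ?thesis
        unfolding dg w_def[symmetric] by (simp add: Suc algebra_simps)
    qed
  qed
  \<comment> \<open>Near \<open>a\<close> the derivative of the extension is bounded, so
    \<open>(z - a) * deriv g z\<close> drops out in the limit.\<close>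
  have "isCont (deriv g) a"
    using holomorphic_deriv[OF g S(1)] S
    by (metis continuous_on_eq_continuous_at holomorphic_on_imp_continuous_on)
  then have "((\<lambda>z. (z - a) * deriv g z - of_nat p * (f z * (z - a) ^ p))
      \<longlongrightarrow> (a - a) * deriv g a - of_nat p * c) (at a)"
    by (intro tendsto_intros lim) (simp add: isCont_def)
  moreover have "\<forall>\<^sub>F z in at a. z \<in> S - {a}"
    using S by (intro eventually_at_in_open)
  ultimately show ?thesis
    by (subst tendsto_cong[where g = "\<lambda>z. (z - a) * deriv g z - of_nat p * (f z * (z - a) ^ p)"])
       (auto elim!: eventually_mono simp del: power_Suc simp: g')
qed

text \<open>Differentiating the pole of order \<open>Suc i\<close> contributes a factor
  \<open>-(i + 1)\<close>; these factors multiply up to \<open>(-1) ^ i * fact i\<close>.\<close>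

lemma higher_deriv_simple_pole_tendsto:
  fixes f :: "complex \<Rightarrow> complex"
  assumes S: "open S" "a \<in> S" and holo: "f holomorphic_on S - {a}"
    and lim: "((\<lambda>z. f z * (z - a)) \<longlongrightarrow> c) (at a)"
  shows "((\<lambda>z. (deriv ^^ i) f z * (z - a) ^ Suc i) \<longlongrightarrow> (-1) ^ i * fact i * c) (at a)"
proof (induction i)
  case 0
  show ?case
    using lim by simp
next
  case (Suc i)
  have "(deriv ^^ i) f holomorphic_on S - {a}"
    using S by (intro holomorphic_higher_deriv holo) auto
  from deriv_times_power_tendsto[OF S this Suc.IH] show ?case
    by (simp add: algebra_simps)
qed

lemma higher_deriv_Gamma_tendsto:
  "((\<lambda>z::complex. (deriv ^^ i) Gamma z * (z + of_nat m) ^ Suc i)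
     \<longlongrightarrow> (-1) ^ i * fact i * ((-1) ^ m / fact m)) (at (- of_nat m))"
proof -
  \<comment> \<open>All poles except \<open>- of_nat m\<close> are removed. What is removed is a set
    of integers, hence closed.\<close>
  let ?S = "- (\<int>\<^sub>\<le>\<^sub>0 - {- of_nat m :: complex})"
  have "open ?S"
    by (intro open_Compl closed_subset_Ints) (auto simp: nonpos_Ints_def)
  moreover have "Gamma holomorphic_on ?S - {- of_nat m}"
    by (rule holomorphic_Gamma) auto
  moreover have "((\<lambda>z. Gamma z * (z - (- of_nat m))) \<longlongrightarrow> (-1) ^ m / fact m) (at (- of_nat m :: complex))"
    using Gamma_residues[of m, where 'a = complex] by simp
  ultimately show ?thesis
    using higher_deriv_simple_pole_tendsto[of ?S "- of_nat m" Gamma "(-1) ^ m / fact m" i] by simp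
qed

lemma higher_deriv_Gamma_scaled_tendsto:
  fixes n k :: nat
  assumes "n \<ge> 1"
  shows "((\<lambda>z::complex. (deriv ^^ i) Gamma (of_nat n * z) * (z + of_nat k) ^ Suc i)
     \<longlongrightarrow> (-1) ^ i * fact i * ((-1) ^ (n * k) / fact (n * k)) / of_nat n ^ Suc i) (at (- of_nat k))"
proof -
  have n: "(of_nat n :: complex) \<noteq> 0"
    using assms by simp
  \<comment> \<open>Composing with a limit at a pole needs \<open>of_nat n * z\<close> to avoid the
    pole itself, which holds since scaling by a nonzero \<open>n\<close> is injective.\<close>
  have "filterlim (\<lambda>z::complex. of_nat n * z) (at (- of_nat (n * k))) (at (- of_nat k))"
    unfolding filterlim_at
  proof
    have "of_nat n * z \<noteq> - of_nat (n * k)" if "z \<noteq> - of_nat k" for z :: complex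
    proof -
      have "of_nat n * z \<noteq> of_nat n * (- of_nat k)"
        using n that by (subst mult_left_cancel) auto
      then show ?thesis
        by simp
    qed
    then show "\<forall>\<^sub>F z in at (- of_nat k :: complex). of_nat n * z \<in> UNIV \<and> of_nat n * z \<noteq> - of_nat (n * k)"
      by (auto simp: eventually_at_filter)
    show "((\<lambda>z::complex. of_nat n * z) \<longlongrightarrow> - of_nat (n * k)) (at (- of_nat k))"
      by (auto intro!: tendsto_eq_intros)
  qed
  from tendsto_divide[OF filterlim_compose[OF higher_deriv_Gamma_tendsto this] tendsto_const, of "of_nat n ^ Suc i" i]
  have "((\<lambda>z::complex. (deriv ^^ i) Gamma (of_nat n * z)
        * (of_nat n * z + of_nat (n * k)) ^ Suc i / of_nat n ^ Suc i)
     \<longlongrightarrow> (-1) ^ i * fact i * ((-1) ^ (n * k) / fact (n * k)) / of_nat n ^ Suc i) (at (- of_nat k))"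
    using n by (simp del: power_Suc)
  moreover have "(of_nat n * z + of_nat (n * k)) ^ Suc i / of_nat n ^ Suc i = (z + of_nat k) ^ Suc i"
    for z :: complex
  proof -
    have "of_nat n * z + of_nat (n * k) = of_nat n * (z + of_nat k)"
      by (simp add: distrib_left)
    then show ?thesis
      using n by (simp only: power_mult_distrib) simp
  qed
  ultimately show ?thesis
    by (simp only: times_divide_eq_right[symmetric])
qed

theorem theorem1p1:
  fixes n q i k :: nat
  assumes "n \<ge> 1" and "q \<ge> 1"
  shows "((\<lambda>z::complex. (deriv ^^ i) Gamma (of_nat n * z) / (deriv ^^ i) Gamma (of_nat q * z))
           \<longlongrightarrow> (-1) powi ((int n - int q) * int k) * (of_nat q / of_nat n) ^ (i + 1)
               * (fact (q * k) / fact (n * k)))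
         (at (- of_nat k))"
proof -
  let ?L = "\<lambda>n. (-1) ^ i * fact i * ((-1) ^ (n * k) / fact (n * k)) / of_nat n ^ Suc i :: complex"
  let ?G = "\<lambda>n z. (deriv ^^ i) Gamma (of_nat n * z) * (z + of_nat k) ^ Suc i :: complex"
  \<comment> \<open>The limits may be divided because \<open>?L q\<close> is nonzero.\<close>
  have lim: "((\<lambda>z. ?G n z / ?G q z) \<longlongrightarrow> ?L n / ?L q) (at (- of_nat k))"
    using assms by (intro tendsto_divide higher_deriv_Gamma_scaled_tendsto) auto
  have ev: "\<forall>\<^sub>F z in at (- of_nat k). ?G n z / ?G q z
      = (deriv ^^ i) Gamma (of_nat n * z) / (deriv ^^ i) Gamma (of_nat q * z)"
    by (auto simp: eventually_at_filter eq_neg_iff_add_eq_0)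
  \<comment> \<open>The exponent is negative when \<open>n < q\<close> and \<open>k > 0\<close>, so
    the sign is split into a quotient of natural powers.\<close>
  have "(-1 :: complex) powi ((int n - int q) * int k) = (-1) powi (int (n * k) - int (q * k))"
    by (simp add: algebra_simps)
  also have "\<dots> = (-1) ^ (n * k) / (-1) ^ (q * k)"
    by (subst power_int_diff) (simp_all only: power_int_of_nat, auto)
  finally have sign: "(-1 :: complex) powi ((int n - int q) * int k) = (-1) ^ (n * k) / (-1) ^ (q * k)" .
  \<comment> \<open>Here \<open>c\<close> stands for \<open>(-1) ^ i * fact i\<close>,
    \<open>s\<close> and \<open>t\<close> for the signs, \<open>x\<close> and \<open>y\<close> for
    the factorials, \<open>N\<close> and \<open>Q\<close> for the powers of \<open>n\<close> and
    \<open>q\<close>.\<close>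
  have cancel: "c * (s / x) / N / (c * (t / y) / Q) = s / t * (Q / N) * (y / x)"
    if "c \<noteq> 0" for c s t x y N Q :: complex
    using that by (simp add: mult_ac)
  have "?L n / ?L q = (-1) powi ((int n - int q) * int k)
      * (of_nat q / of_nat n) ^ (i + 1) * (fact (q * k) / fact (n * k))"
    unfolding sign power_divide Suc_eq_plus1 by (rule cancel) simp
  with Lim_transform_eventually[OF lim ev] show ?thesis
    by (simp only:)
qed

end
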